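(* Let $T_1=\lambda n((n)\delta)G$, where $G=\lambda x\lambda y(x)\lambda z(y)(\underline{s})z$ and $\delta=\lambda f(f)\underline{0}$. Let $u\in N_{x,f}$ be without free $\mu$-variables and such that $\mathrm{val}(u)=\{n\}$, and let $\theta=\lambda x\lambda f\,u$. Then $((T_1)\theta)f\succ(f)(\underline{s})^n\underline{0}$ (where the outer $f$ is a free $\lambda$-variable).
   Context: **$\lambda\mu$-terms.** There are two disjoint alphabets of variables: $\lambda$-variables $x,y,z,\dots$ and $\mu$-variables $\alpha,\beta,\gamma,\dots$. Terms are generated by: a $\lambda$-variable $x$; $\lambda x\,u$; application $(u)v$; and $\mu\alpha[\beta]t$ ($\alpha,\beta$ $\mu$-variables, possibly equal, $t$ a term). $\lambda x$ binds $x$ and $\mu\alpha$ binds $\alpha$. An expression $[\alpha]t$ is called a named term. Terms are considered up to renaming of bound variables; in each term the free and bound variables are assumed distinct and each bound variable is bound only once. Below, in $\mu\alpha u$, $u$ denotes a named term. Application notation: $(a)(b)c$ means $(a)((b)c)$, and $(a)^n b$ is $(a)(a)\cdots(a)b$ ($n$ times). **Reduction.** Computation rules: $(C_1)$ $(\lambda x u)v\to u[v/x]$; $(C_2)$ $(\mu\alpha u)v\to\mu\alpha\,u[v/{*}\alpha]$, where $u[v/{*}\alpha]$ is obtained by inductively replacing each subterm $[\alpha]w$ of $u$ by $[\alpha](w)v$. Simplification rules: $(S_1)$ $[\alpha]\mu\beta u\to u[\alpha/\beta]$; $(S_2)$ $\mu\alpha[\alpha]u\to u$ if $\alpha$ is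 not free in $u$; $(S_3)$ $\mu\alpha u\to\lambda x\mu\alpha\,u[x/{*}\alpha]$ ($x$ fresh) if $u$ contains a subterm of the form $[\alpha]\lambda y w$. **Head reduction.** The set $H$ of head normal forms is defined inductively: $\lambda$-variables are in $H$; if $u\in H$ then $\lambda xu\in H$; if $u\in H$ and $(u)v$ is not a redex then $(u)v\in H$; if $u\in H$ and $\mu\alpha[\beta]u$ is not a redex then $\mu\alpha[\beta]u\in H$. A head reduction is a sequence $t_1,\dots,t_k$ such that for all $1\le i\le k-1$, $t_i$ is not in head normal form and $t_{i+1}$ is obtained from $t_i$ by reducing the leftmost redex. Write $t\succ u$ if $u$ is obtained from $t$ by a head reduction. **Integers.** $\underline{0}=\lambda x\lambda f\,x$ and $\underline{s}=\lambda n\lambda x\lambda f(f)((n)x)f$. **The set $N_{x,f}$.** Fix two $\lambda$-variables $x,f$. $N_{x,f}$ is the smallest set of $\lambda\mu$-terms with: $x\in N_{x,f}$; $\mu\alpha[\beta]x\in N_{x,f}$; if $u\in N_{x,f}$ then $(f)u\in N_{x,f}$ and $\mu\alpha[\beta](f)u\in N_{x,f}$ (for all $\mu$-variables $\alpha,\beta$). **The set $\mathrm{val}(u)$**, defined inductively for $u\in N_{x,f}$ (and its subterms): $\mathrm{val}(x)=\{0\}$; $\mathrm{val}((f)u)=\{n+1: n\in\mathrm{val}(u)\}$; $\mathrm{val}(\mu\alpha[\beta]u)=\bigcup\mathrm{val}(v)$, the union over all subterms $[\alpha]v$ of $[\beta]u$ (including $[\beta]u$ itself if $\beta=\alpha$;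 an empty union is $\emptyset$). *)

theory Defs
  imports Main
begin

text \<open>
  Terms up to renaming of bound variables are represented by de Bruijn indices, with separate
  index spaces for the \<open>\<lambda>\<close>-variables and the \<open>\<mu>\<close>-variables: \<open>Lam\<close> binds \<open>\<lambda>\<close>-index 0 and leaves
  \<open>\<mu>\<close>-indices alone, \<open>Mu\<close> binds \<open>\<mu>\<close>-index 0 and leaves \<open>\<lambda>\<close>-indices alone.
  \<open>Mu (Named b t)\<close> is \<open>\<mu>\<alpha>[\<beta>]t\<close>; the label \<open>b\<close> is already in the scope of \<open>\<alpha>\<close>, so \<open>b = 0\<close> means
  \<open>\<beta> = \<alpha>\<close>. \<open>App u v\<close> is \<open>(u)v\<close>.
\<close>

datatype trm = Var nat | Lam trm | App trm trm | Mu named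
     and named = Named nat trm

primrec liftL :: "trm \<Rightarrow> nat \<Rightarrow> trm" and liftL_n :: "named \<Rightarrow> nat \<Rightarrow> named" where
  "liftL (Var i) k = Var (if i < k then i else Suc i)"
| "liftL (Lam t) k = Lam (liftL t (Suc k))"
| "liftL (App t u) k = App (liftL t k) (liftL u k)"
| "liftL (Mu c) k = Mu (liftL_n c k)"
| "liftL_n (Named b t) k = Named b (liftL t k)"

primrec liftM :: "trm \<Rightarrow> nat \<Rightarrow> trm" and liftM_n :: "named \<Rightarrow> nat \<Rightarrow> named" where
  "liftM (Var i) k = Var i"
| "liftM (Lam t) k = Lam (liftM t k)"
| "liftM (App t u) k = App (liftM t k) (liftM u k)"
| "liftM (Mu c) k = Mu (liftM_n c (Suc k))"
| "liftM_n (Named b t) k = Named (if b < k then b else Suc b) (liftM t k)"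

text \<open>
  \<open>subst t v k\<close> is \<open>t[v/x]\<close>, where \<open>x\<close> has index \<open>k\<close> and its binder disappears;
  \<open>rename u a k\<close> is \<open>u[\<alpha>/\<beta>]\<close>, where \<open>\<beta>\<close> has index \<open>k\<close> and its binder disappears, and \<open>a\<close> is
  the index of \<open>\<alpha>\<close> once that binder is gone.
\<close>

primrec subst :: "trm \<Rightarrow> trm \<Rightarrow> nat \<Rightarrow> trm" and subst_n :: "named \<Rightarrow> trm \<Rightarrow> nat \<Rightarrow> named" where
  "subst (Var i) v k = (if i < k then Var i else if i = k then v else Var (i - 1))"
| "subst (Lam t) v k = Lam (subst t (liftL v 0) (Suc k))"
| "subst (App t u) v k = App (subst t v k) (subst u v k)"
| "subst (Mu c) v k = Mu (subst_n c (liftM v 0) k)"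
| "subst_n (Named b t) v k = Named b (subst t v k)"

primrec rename :: "trm \<Rightarrow> nat \<Rightarrow> nat \<Rightarrow> trm" and rename_n :: "named \<Rightarrow> nat \<Rightarrow> nat \<Rightarrow> named" where
  "rename (Var i) a k = Var i"
| "rename (Lam t) a k = Lam (rename t a k)"
| "rename (App t u) a k = App (rename t a k) (rename u a k)"
| "rename (Mu c) a k = Mu (rename_n c (Suc a) (Suc k))"
| "rename_n (Named b t) a k =
     Named (if b < k then b else if b = k then a else b - 1) (rename t a k)"

text \<open>\<open>ssubst t v a\<close> is \<open>t[v/*\<alpha>]\<close>, where \<open>\<alpha>\<close> has index \<open>a\<close>; no binder disappears here.\<close>

primrec ssubst :: "trm \<Rightarrow> trm \<Rightarrow> nat \<Rightarrow> trm" and ssubst_n :: "named \<Rightarrow> trm \<Rightarrow> nat \<Rightarrow> named" where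
  "ssubst (Var i) v a = Var i"
| "ssubst (Lam t) v a = Lam (ssubst t (liftL v 0) a)"
| "ssubst (App t u) v a = App (ssubst t v a) (ssubst u v a)"
| "ssubst (Mu c) v a = Mu (ssubst_n c (liftM v 0) (Suc a))"
| "ssubst_n (Named b t) v a = Named b (if b = a then App (ssubst t v a) v else ssubst t v a)"

text \<open>Free \<open>\<mu>\<close>-variables.\<close>

primrec fmv :: "trm \<Rightarrow> nat set" and fmv_n :: "named \<Rightarrow> nat set" where
  "fmv (Var i) = {}"
| "fmv (Lam t) = fmv t"
| "fmv (App t u) = fmv t \<union> fmv u"
| "fmv (Mu c) = {i. Suc i \<in> fmv_n c}"
| "fmv_n (Named b t) = insert b (fmv t)"

text \<open>
  The set of all \<open>v\<close> such that \<open>[\<alpha>]v\<close> is a subterm, where \<open>\<alpha>\<close> has index \<open>a\<close>. The indices of such a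
  \<open>v\<close> refer to the place where it occurs.
\<close>

primrec named_subs :: "nat \<Rightarrow> trm \<Rightarrow> trm set" and named_subs_n :: "nat \<Rightarrow> named \<Rightarrow> trm set" where
  "named_subs a (Var i) = {}"
| "named_subs a (Lam t) = named_subs a t"
| "named_subs a (App t u) = named_subs a t \<union> named_subs a u"
| "named_subs a (Mu c) = named_subs_n (Suc a) c"
| "named_subs_n a (Named b t) = (if b = a then {t} else {}) \<union> named_subs a t"


text \<open>
  Contraction of a redex at the root. The redexes of rule \<open>S1\<close> are named terms, all the others are
  terms. In \<open>S2\<close> index 0 does not occur in \<open>t\<close>, so the renaming only removes the binder.
\<close>

inductive contract :: "trm \<Rightarrow> trm \<Rightarrow> bool" where
  C1: "contract (App (Lam u) v) (subst u v 0)"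
| C2: "contract (App (Mu c) v) (Mu (ssubst_n c (liftM v 0) 0))"
| S2: "0 \<notin> fmv t \<Longrightarrow> contract (Mu (Named 0 t)) (rename t 0 0)"
| S3: "Lam w \<in> named_subs_n 0 c \<Longrightarrow> contract (Mu c) (Lam (Mu (ssubst_n (liftL_n c 0) (Var 0) 0)))"

inductive contract_n :: "named \<Rightarrow> named \<Rightarrow> bool" where
  S1: "contract_n (Named a (Mu c)) (rename_n c a 0)"

definition redex :: "trm \<Rightarrow> bool" where
  "redex t \<longleftrightarrow> (\<exists>t'. contract t t')"

definition redex_n :: "named \<Rightarrow> bool" where
  "redex_n c \<longleftrightarrow> (\<exists>c'. contract_n c c')"

primrec has_redex :: "trm \<Rightarrow> bool" and has_redex_n :: "named \<Rightarrow> bool" where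
  "has_redex (Var i) \<longleftrightarrow> False"
| "has_redex (Lam t) \<longleftrightarrow> has_redex t"
| "has_redex (App t u) \<longleftrightarrow> redex (App t u) \<or> has_redex t \<or> has_redex u"
| "has_redex (Mu c) \<longleftrightarrow> redex (Mu c) \<or> has_redex_n c"
| "has_redex_n (Named b t) \<longleftrightarrow> redex_n (Named b t) \<or> has_redex t"

text \<open>
  Reduction of the leftmost redex, that is, of the redex whose first symbol comes first in the
  written term: a redex precedes all redexes inside it, and those of \<open>u\<close> precede those of \<open>v\<close> in
  \<open>(u)v\<close>. A \<open>\<mu>\<close>-term can be a redex for \<open>S2\<close> and \<open>S3\<close> at the same time; either rule may then be used.
\<close>

inductive leftmost :: "trm \<Rightarrow> trm \<Rightarrow> bool" and leftmost_n :: "named \<Rightarrow> named \<Rightarrow> bool" where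
  root: "contract t t' \<Longrightarrow> leftmost t t'"
| Lam: "leftmost u u' \<Longrightarrow> leftmost (Lam u) (Lam u')"
| App_left: "\<not> redex (App u v) \<Longrightarrow> leftmost u u' \<Longrightarrow> leftmost (App u v) (App u' v)"
| App_right: "\<not> redex (App u v) \<Longrightarrow> \<not> has_redex u \<Longrightarrow> leftmost v v' \<Longrightarrow>
    leftmost (App u v) (App u v')"
| Mu: "\<not> redex (Mu c) \<Longrightarrow> leftmost_n c c' \<Longrightarrow> leftmost (Mu c) (Mu c')"
| root_n: "contract_n c c' \<Longrightarrow> leftmost_n c c'"
| Named: "\<not> redex_n (Named b t) \<Longrightarrow> leftmost t t' \<Longrightarrow> leftmost_n (Named b t) (Named b t')"

text \<open>
  Head normal forms. In the last clause only the term \<open>\<mu>\<alpha>[\<beta>]u\<close> itself is required not to be a redex;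
  the named term \<open>[\<beta>]u\<close> may still be an \<open>S1\<close>-redex. Excluding that case as well would shrink \<open>hnf\<close>
  and hence only enlarge \<open>\<succ>\<close>.
\<close>

inductive_set hnf :: "trm set" where
  Var: "Var i \<in> hnf"
| Lam: "u \<in> hnf \<Longrightarrow> Lam u \<in> hnf"
| App: "u \<in> hnf \<Longrightarrow> \<not> redex (App u v) \<Longrightarrow> App u v \<in> hnf"
| Mu: "u \<in> hnf \<Longrightarrow> \<not> redex (Mu (Named b u)) \<Longrightarrow> Mu (Named b u) \<in> hnf"

definition head_step :: "trm \<Rightarrow> trm \<Rightarrow> bool" where
  "head_step t t' \<longleftrightarrow> t \<notin> hnf \<and> leftmost t t'"

definition head_red :: "trm \<Rightarrow> trm \<Rightarrow> bool"  (infix \<open>\<succ>\<close> 50) where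
  "t \<succ> u \<longleftrightarrow> head_step\<^sup>*\<^sup>* t u"


definition zero :: trm where
  "zero = Lam (Lam (Var 1))"

definition s :: trm where
  "s = Lam (Lam (Lam (App (Var 0) (App (App (Var 2) (Var 1)) (Var 0)))))"

text \<open>
  The \<open>\<lambda>\<close>-variables \<open>x\<close> and \<open>f\<close> are given by their indices, which are the same throughout a term of
  \<open>N x f\<close> because such a term contains no \<open>\<lambda>\<close>. In \<open>N_Mu_x\<close> and \<open>N_Mu_f\<close>, \<open>b = 0\<close> covers \<open>\<beta> = \<alpha>\<close>, and
  \<open>u\<close> may contain the \<open>\<mu>\<close>-variable that gets bound.
\<close>

inductive_set N :: "nat \<Rightarrow> nat \<Rightarrow> trm set" for x f :: nat where
  N_x: "Var x \<in> N x f"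
| N_Mu_x: "Mu (Named b (Var x)) \<in> N x f"
| N_f: "u \<in> N x f \<Longrightarrow> App (Var f) u \<in> N x f"
| N_Mu_f: "u \<in> N x f \<Longrightarrow> Mu (Named b (App (Var f) u)) \<in> N x f"

lemma size_named_subs:
  "v \<in> named_subs a t \<Longrightarrow> size v < size t"
  "v \<in> named_subs_n a c \<Longrightarrow> size v < size c"
  by (induction t and c arbitrary: a and a) (fastforce split: if_splits)+

text \<open>Only meaningful for terms in \<open>N x f\<close>; on other terms the value is a dummy.\<close>

function val :: "nat \<Rightarrow> nat \<Rightarrow> trm \<Rightarrow> nat set" where
  "val x f (Var i) = (if i = x then {0} else {})"
| "val x f (App t u) = (if t = Var f then {n + 1 |n. n \<in> val x f u} else {})"
| "val x f (Mu c) = (\<Union>v\<in>named_subs_n 0 c. val x f v)"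
| "val x f (Lam t) = {}"
  by pat_completeness auto
termination
  by (relation "measure (\<lambda>(x, f, t). size t)") (auto dest: size_named_subs(2))


definition G :: trm where
  "G = Lam (Lam (App (Var 1) (Lam (App (Var 1) (App s (Var 0))))))"

definition \<delta> :: trm where
  "\<delta> = Lam (App (Var 0) zero)"

definition T1 :: trm where
  "T1 = Lam (App (App (Var 0) \<delta>) G)"

end

theory Submission
  imports Defs
begin

text \<open>
  Write \<open>W 0 = f\<close>, for the free variable \<open>f\<close>, and \<open>W (k + 1) = \<lambda>z (W k)(s)z\<close>, and for a subterm \<open>q\<close>
  of \<open>u\<close> let \<open>q'\<close> be \<open>q\<close> with \<open>\<delta>\<close> for \<open>x\<close> and \<open>G\<close> for the bound \<open>f\<close> of \<open>\<theta>\<close>.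
  After three \<open>\<beta>\<close>-steps the term is \<open>(u')W 0\<close>, and from there head reduction behaves like an abstract
  machine that walks down \<open>u\<close> and counts:
  \<^item> \<open>(G q')W k\<close> reduces to \<open>(q')W (k + 1)\<close>;
  \<^item> \<open>(\<mu>\<gamma>[\<beta>]q')W k\<close> stores \<open>k\<close> as the level of \<open>\<gamma>\<close> and continues with \<open>q'\<close> at the level of \<open>\<beta>\<close>;
  \<^item> \<open>(\<delta>)W k\<close> reduces to \<open>(W k)0\<close> and then to \<open>(f)(s)\<^sup>k0\<close>.

  A stored level lives in the term itself: rule \<open>C2\<close> turns every \<open>[\<gamma>]v\<close> into \<open>[\<gamma>](v)W k\<close>, and \<open>S1\<close>
  then identifies \<open>\<gamma>\<close> with the one \<open>\<mu>\<close>-variable \<open>\<alpha>\<close> that may be bound in front of the term. So the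
  machine state "\<open>q\<close>, levels \<open>\<rho>\<close>, current level \<open>k\<close>" is the term \<open>(q'')W k\<close> or \<open>\<mu>\<alpha>[\<alpha>](q'')W k\<close>,
  where \<open>q''\<close> is \<open>q'\<close> with every free \<open>[\<beta>]v\<close> replaced by \<open>[\<alpha>](v)W (\<rho> \<beta>)\<close> (this is \<open>plug\<close> below).
  The binder disappears by \<open>S2\<close> as soon as \<open>\<alpha>\<close> does not occur in \<open>q''\<close>, and \<open>S3\<close> never competes,
  since every term named \<open>\<alpha>\<close> is an application.

  The count agrees with \<open>val\<close> because of an invariant (\<open>fits\<close>): the current level added to a value
  of \<open>q\<close> is \<open>n\<close>, and the level of \<open>\<beta>\<close> added to a value of \<open>v\<close> is \<open>n\<close> for every \<open>[\<beta>]v\<close> in \<open>q\<close>. It holds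
  initially because \<open>val(u) = {n}\<close> and \<open>u\<close> has no free \<open>\<mu>\<close>-variable; at \<open>\<mu>\<gamma>[\<beta>]q\<close> it is the very
  definition of \<open>val\<close> that preserves it; at \<open>x\<close> it says that the current level is \<open>n\<close>. The walk ends
  since \<open>q\<close> shrinks, so the proof is an induction on \<open>N\<close>, carried by \<open>runs_x\<close>, \<open>runs_f\<close> and
  \<open>runs_Mu\<close>.
\<close>

section \<open>Terms without a given free variable\<close>

lemma fmv_liftL [simp]:
  "fmv (liftL t k) = fmv t"
  "fmv_n (liftL_n c k) = fmv_n c"
  by (induction t and c arbitrary: k and k) auto

lemma Lam_named_subs_liftL:
  "(\<exists>w. Lam w \<in> named_subs a (liftL t k)) \<longleftrightarrow> (\<exists>w. Lam w \<in> named_subs a t)"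
  "(\<exists>w. Lam w \<in> named_subs_n a (liftL_n c k)) \<longleftrightarrow> (\<exists>w. Lam w \<in> named_subs_n a c)"
proof (induction t and c arbitrary: a k and a k)
  case (Named b t)
  have "(\<exists>w. Lam w = liftL t k) \<longleftrightarrow> (\<exists>w. Lam w = t)"
    by (cases t) auto
  with Named show ?case
    by (cases "b = a") (simp_all add: ex_disj_distrib)
qed (simp_all add: ex_disj_distrib)

lemma subst_liftL [simp]:
  "subst (liftL t k) v k = t"
  "subst_n (liftL_n c k) v k = c"
  by (induction t and c arbitrary: k v and k v) auto

lemma liftM_fresh:
  "\<forall>i\<in>fmv t. i < k \<Longrightarrow> liftM t k = t"
  "\<forall>i\<in>fmv_n c. i < k \<Longrightarrow> liftM_n c k = c"
proof (induction t and c arbitrary: k and k)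
  case (Mu c)
  have "\<forall>i\<in>fmv_n c. i < Suc k"
  proof
    fix i assume "i \<in> fmv_n c"
    with Mu.prems show "i < Suc k" by (cases i) auto
  qed
  with Mu.IH show ?case by simp
qed auto

lemma rename_fresh:
  "\<forall>i\<in>fmv t. i < k \<Longrightarrow> rename t a k = t"
  "\<forall>i\<in>fmv_n c. i < k \<Longrightarrow> rename_n c a k = c"
proof (induction t and c arbitrary: a k and a k)
  case (Mu c)
  have "\<forall>i\<in>fmv_n c. i < Suc k"
  proof
    fix i assume "i \<in> fmv_n c"
    with Mu.prems show "i < Suc k" by (cases i) auto
  qed
  with Mu.IH show ?case by simp
qed auto

lemma ssubst_fresh:
  "a \<notin> fmv t \<Longrightarrow> ssubst t v a = t"
  "a \<notin> fmv_n c \<Longrightarrow> ssubst_n c v a = c"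
  by (induction t and c arbitrary: v a and v a) auto

lemma named_subs_fresh:
  "a \<notin> fmv t \<Longrightarrow> named_subs a t = {}"
  "a \<notin> fmv_n c \<Longrightarrow> named_subs_n a c = {}"
  by (induction t and c arbitrary: a and a) auto


section \<open>Head steps\<close>

lemma redex_App [simp]: "redex (App u v) \<longleftrightarrow> (\<exists>t. u = Lam t) \<or> (\<exists>c. u = Mu c)"
  unfolding redex_def by (auto elim: contract.cases intro: contract.intros)

lemma redex_Mu:
  "redex (Mu (Named b t)) \<longleftrightarrow>
    b = 0 \<and> 0 \<notin> fmv t \<or> (\<exists>w. Lam w \<in> named_subs_n 0 (Named b t))"
  unfolding redex_def by (blast elim: contract.cases intro: contract.intros)

lemma redex_n [simp]: "redex_n (Named b t) \<longleftrightarrow> (\<exists>c. t = Mu c)"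
  unfolding redex_n_def by (auto elim: contract_n.cases intro: contract_n.intros)

lemma hnf_App: "App u v \<in> hnf \<longleftrightarrow> u \<in> hnf \<and> \<not> redex (App u v)"
  by (auto elim: hnf.cases intro: hnf.intros simp del: redex_App)

lemma hnf_Mu: "Mu (Named b u) \<in> hnf \<longleftrightarrow> u \<in> hnf \<and> \<not> redex (Mu (Named b u))"
  by (auto elim: hnf.cases intro: hnf.intros)

lemma head_step_App_root: "contract (App u v) t \<Longrightarrow> head_step (App u v) t"
  unfolding head_step_def by (metis hnf_App leftmost_leftmost_n.root redex_def)

lemma head_step_Mu_root: "contract (Mu c) t \<Longrightarrow> head_step (Mu c) t"
  unfolding head_step_def by (metis hnf_Mu leftmost_leftmost_n.root named.exhaust redex_def)

lemma head_step_App: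
  "head_step t t' \<Longrightarrow> \<not> redex (App t v) \<Longrightarrow> head_step (App t v) (App t' v)"
  unfolding head_step_def by (metis hnf_App leftmost_leftmost_n.App_left)

lemma head_step_Mu:
  "head_step t t' \<Longrightarrow> \<not> redex (Mu (Named b t)) \<Longrightarrow> \<not> redex_n (Named b t) \<Longrightarrow>
    head_step (Mu (Named b t)) (Mu (Named b t'))"
  unfolding head_step_def by (metis hnf_Mu leftmost_leftmost_n.Mu leftmost_leftmost_n.Named)

text \<open>
  A term whose named body is an \<open>S1\<close>-redex can still be in \<open>hnf\<close>, so the step needs a reason in
  the body for not being head normal.
\<close>

lemma head_step_S1:
  assumes "\<not> redex (Mu (Named b (Mu c)))" and "Mu c \<notin> hnf"
  shows "head_step (Mu (Named b (Mu c))) (Mu (rename_n c b 0))"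
  unfolding head_step_def
  using assms hnf_Mu leftmost_leftmost_n.Mu leftmost_leftmost_n.root_n contract_n.S1 by blast

lemma head_red_step: "head_step t t' \<Longrightarrow> t' \<succ> u \<Longrightarrow> t \<succ> u"
  unfolding head_red_def by (rule converse_rtranclp_into_rtranclp)


section \<open>Machine states as terms\<close>

text \<open>
  An environment sends a \<open>\<mu>\<close>-variable to its new name and, if it has already received an argument,
  to that argument.
\<close>

type_synonym env = "nat \<Rightarrow> nat \<times> trm option"

definition up :: "env \<Rightarrow> env" where
  "up \<sigma> = case_nat (0, None) (\<lambda>i. apfst Suc (\<sigma> i))"

fun apply_opt :: "trm \<Rightarrow> trm option \<Rightarrow> trm" where
  "apply_opt t None = t"
| "apply_opt t (Some w) = App t w"

text \<open>
  Elements of \<open>N 1 0\<close> contain no \<open>\<lambda>\<close>, so the value at \<open>Lam t\<close> is a dummy; with a combinator there,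
  most facts below hold for all terms and follow by structural induction. Arguments are meant to
  have no free \<open>\<mu>\<close>-variables and hence need no lifting in \<open>up\<close>.
\<close>

primrec plug :: "trm \<Rightarrow> env \<Rightarrow> trm" and plug_n :: "named \<Rightarrow> env \<Rightarrow> named" where
  "plug (Var i) \<sigma> = (if i = 1 then \<delta> else G)"
| "plug (Lam t) \<sigma> = \<delta>"
| "plug (App t u) \<sigma> = App (plug t \<sigma>) (plug u \<sigma>)"
| "plug (Mu c) \<sigma> = Mu (plug_n c (up \<sigma>))"
| "plug_n (Named b t) \<sigma> = Named (fst (\<sigma> b)) (apply_opt (plug t \<sigma>) (snd (\<sigma> b)))"

lemma up_simps [simp]:
  "up \<sigma> 0 = (0, None)"
  "fst (up \<sigma> (Suc i)) = Suc (fst (\<sigma> i))"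
  "snd (up \<sigma> (Suc i)) = snd (\<sigma> i)"
  by (simp_all add: up_def)

definition closed_args :: "env \<Rightarrow> bool" where
  "closed_args \<sigma> \<longleftrightarrow> (\<forall>i w. snd (\<sigma> i) = Some w \<longrightarrow> fmv w = {})"

lemma closed_args_up [simp]: "closed_args (up \<sigma>) = closed_args \<sigma>"
proof
  assume *: "closed_args (up \<sigma>)"
  show "closed_args \<sigma>"
    unfolding closed_args_def
  proof (intro allI impI)
    fix i w assume "snd (\<sigma> i) = Some w"
    then have "snd (up \<sigma> (Suc i)) = Some w" by simp
    with * show "fmv w = {}" unfolding closed_args_def by blast
  qed
next
  assume *: "closed_args \<sigma>"
  show "closed_args (up \<sigma>)"
    unfolding closed_args_def
  proof (intro allI impI)
    fix i w assume "snd (up \<sigma> i) = Some w"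
    with * show "fmv w = {}" unfolding closed_args_def by (cases i) auto
  qed
qed

lemma fmv_apply_opt: "closed_args \<sigma> \<Longrightarrow> fmv (apply_opt t (snd (\<sigma> i))) = fmv t"
  by (cases "snd (\<sigma> i)") (auto simp: closed_args_def)

lemma fmv_combinators [simp]: "fmv \<delta> = {}" "fmv G = {}" "fmv s = {}"
  by (auto simp: \<delta>_def G_def s_def zero_def)

lemma liftM_combinators [simp]: "liftM \<delta> k = \<delta>" "liftM G k = G"
  by (simp_all add: liftM_fresh)

lemma rename_combinators [simp]: "rename \<delta> a k = \<delta>" "rename G a k = G"
  by (simp_all add: rename_fresh)

lemma ssubst_combinators [simp]: "ssubst \<delta> v a = \<delta>" "ssubst G v a = G"
  by (simp_all add: ssubst_fresh)

lemma named_subs_combinators [simp]: "named_subs a \<delta> = {}" "named_subs a G = {}"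
  by (simp_all add: named_subs_fresh)

lemma subst_s [simp]: "subst s v k = s"
  by (simp add: s_def)

lemma liftL_combinators [simp]: "liftL \<delta> k = \<delta>" "liftL G k = G"
  by (simp_all add: \<delta>_def G_def s_def zero_def)

lemma subst_\<delta> [simp]: "subst \<delta> v k = \<delta>"
  by (simp add: \<delta>_def zero_def)

text \<open>
  Plain substitution is plugging in the identity environment: \<open>up\<close> preserves that environment, and
  the combinators are closed, so passing under \<open>\<mu>\<close> does not change them.
\<close>

lemma subst_eq_plug:
  "u \<in> N 1 0 \<Longrightarrow> subst (subst u \<delta> 1) G 0 = plug u (\<lambda>i. (i, None))"
proof -
  have [simp]: "up (\<lambda>i. (i, None)) = (\<lambda>i. (i, None))"
    by (auto simp: up_def fun_eq_iff split: nat.split)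
  show "u \<in> N 1 0 \<Longrightarrow> subst (subst u \<delta> 1) G 0 = plug u (\<lambda>i. (i, None))"
    by (induction rule: N.induct) auto
qed

lemma plug_cong:
  "(\<And>i. i \<in> fmv q \<Longrightarrow> \<sigma> i = \<tau> i) \<Longrightarrow> plug q \<sigma> = plug q \<tau>"
  "(\<And>i. i \<in> fmv_n c \<Longrightarrow> \<sigma> i = \<tau> i) \<Longrightarrow> plug_n c \<sigma> = plug_n c \<tau>"
proof (induction q and c arbitrary: \<sigma> \<tau> and \<sigma> \<tau>)
  case (Mu c)
  have "up \<sigma> i = up \<tau> i" if "i \<in> fmv_n c" for i
    using that Mu.prems by (cases i) (auto simp: up_def)
  then have "plug_n c (up \<sigma>) = plug_n c (up \<tau>)" by (rule Mu.IH)
  then show ?case by simp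
next
  case (App t u)
  have "plug t \<sigma> = plug t \<tau>" by (rule App.IH, rule App.prems) simp
  moreover have "plug u \<sigma> = plug u \<tau>" by (rule App.IH, rule App.prems) simp
  ultimately show ?case by simp
next
  case (Named b t)
  have "plug t \<sigma> = plug t \<tau>" by (rule Named.IH, rule Named.prems) simp
  moreover have "\<sigma> b = \<tau> b" by (rule Named.prems) simp
  ultimately show ?case by simp
next
  case (Var i)
  show ?case by simp
next
  case (Lam t)
  show ?case by simp
qed

text \<open>Descending below a \<open>\<mu>\<close> commutes with renaming the free \<open>\<mu>\<close>-variables.\<close>

lemma Collect_Suc_image_up:
  "{i. Suc i \<in> (\<lambda>j. fst (up \<sigma> j)) ` A} = (\<lambda>j. fst (\<sigma> j)) ` {i. Suc i \<in> A}"
proof (intro set_eqI iffI)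
  fix i assume "i \<in> {i. Suc i \<in> (\<lambda>j. fst (up \<sigma> j)) ` A}"
  then obtain j where "j \<in> A" "Suc i = fst (up \<sigma> j)" by auto
  then show "i \<in> (\<lambda>j. fst (\<sigma> j)) ` {i. Suc i \<in> A}" by (cases j) auto
next
  fix i assume "i \<in> (\<lambda>j. fst (\<sigma> j)) ` {i. Suc i \<in> A}"
  then obtain j where "Suc j \<in> A" "i = fst (\<sigma> j)" by auto
  then show "i \<in> {i. Suc i \<in> (\<lambda>j. fst (up \<sigma> j)) ` A}"
    by (auto intro!: rev_image_eqI[of "Suc j"])
qed

lemma fmv_plug:
  "u \<in> N 1 0 \<Longrightarrow> closed_args \<sigma> \<Longrightarrow> fmv (plug u \<sigma>) = (\<lambda>i. fst (\<sigma> i)) ` fmv u"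
proof (induction arbitrary: \<sigma> rule: N.induct)
  case (N_Mu_x b)
  then show ?case
    using Collect_Suc_image_up[of \<sigma> "{b}"] by (simp add: fmv_apply_opt)
next
  case (N_Mu_f u b)
  then show ?case
    using Collect_Suc_image_up[of \<sigma> "insert b (fmv u)"] by (simp add: fmv_apply_opt)
qed auto


lemma up_Suc_imp: "(\<And>i. fst (\<sigma> i) = a \<Longrightarrow> P (snd (\<sigma> i))) \<Longrightarrow> fst (up \<sigma> i) = Suc a \<Longrightarrow> P (snd (up \<sigma> i))"
  by (cases i) auto

text \<open>
  A name all of whose occurrences have received an argument labels only applications, so it cannot
  give rise to \<open>S3\<close>.
\<close>

lemma Lam_notin_named_subs_plug:
  "closed_args \<sigma> \<Longrightarrow> (\<And>i. fst (\<sigma> i) = a \<Longrightarrow> snd (\<sigma> i) \<noteq> None) \<Longrightarrow>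
    Lam w \<notin> named_subs a (plug q \<sigma>)"
  "closed_args \<sigma> \<Longrightarrow> (\<And>i. fst (\<sigma> i) = a \<Longrightarrow> snd (\<sigma> i) \<noteq> None) \<Longrightarrow>
    Lam w \<notin> named_subs_n a (plug_n c \<sigma>)"
proof (induction q and c arbitrary: \<sigma> a and \<sigma> a)
  case (Mu c)
  then show ?case
    using up_Suc_imp[of \<sigma> a "\<lambda>x. x \<noteq> None"] by simp
next
  case (Named b t)
  have IH: "Lam w \<notin> named_subs a (plug t \<sigma>)"
    using Named by blast
  show ?case
  proof (cases "snd (\<sigma> b)")
    case None
    with Named.prems(2)[of b] IH show ?thesis by auto
  next
    case (Some v)
    then have "named_subs a v = {}"
      using Named.prems(1) by (simp add: closed_args_def named_subs_fresh)
    with Some IH show ?thesis by auto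
  qed
qed auto

text \<open>
  The effect of \<open>C2\<close> on an environment. A name may receive only one argument, because an environment
  has room for one.
\<close>

lemma ssubst_plug:
  "closed_args \<sigma> \<Longrightarrow> fmv v = {} \<Longrightarrow> (\<And>i. fst (\<sigma> i) = a \<Longrightarrow> snd (\<sigma> i) = None) \<Longrightarrow>
    ssubst (plug q \<sigma>) v a = plug q (\<lambda>i. if fst (\<sigma> i) = a then (a, Some v) else \<sigma> i)"
  "closed_args \<sigma> \<Longrightarrow> fmv v = {} \<Longrightarrow> (\<And>i. fst (\<sigma> i) = a \<Longrightarrow> snd (\<sigma> i) = None) \<Longrightarrow>
    ssubst_n (plug_n c \<sigma>) v a = plug_n c (\<lambda>i. if fst (\<sigma> i) = a then (a, Some v) else \<sigma> i)"
proof (induction q and c arbitrary: \<sigma> a and \<sigma> a)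
  case (Mu c)
  let ?r = "\<lambda>a \<sigma> i. if fst (\<sigma> i) = a then (a, Some v) else \<sigma> i"
  have "up (?r a \<sigma>) = ?r (Suc a) (up \<sigma>)"
    by (auto simp: up_def fun_eq_iff split: nat.split)
  moreover have "liftM v 0 = v"
    using Mu.prems(2) by (simp add: liftM_fresh)
  ultimately show ?case
    using Mu.IH[of "up \<sigma>" "Suc a"] Mu.prems up_Suc_imp[of \<sigma> a "\<lambda>x. x = None"] by simp
next
  case (Named b t)
  let ?\<tau> = "\<lambda>i. if fst (\<sigma> i) = a then (a, Some v) else \<sigma> i"
  have IH: "ssubst (plug t \<sigma>) v a = plug t ?\<tau>"
    using Named by blast
  show ?case
  proof (cases "snd (\<sigma> b)")
    case None
    with IH show ?thesis by simp
  next
    case (Some w)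
    then have "ssubst w v a = w" "fst (\<sigma> b) \<noteq> a"
      using Named.prems by (auto simp: closed_args_def ssubst_fresh)
    with Some IH show ?thesis by simp
  qed
qed auto

text \<open>The effect of \<open>S1\<close> and \<open>S2\<close> on an environment: both act on the names only.\<close>

lemma rename_plug:
  "closed_args \<sigma> \<Longrightarrow> rename (plug q \<sigma>) a k =
    plug q (\<lambda>i. apfst (\<lambda>b. if b < k then b else if b = k then a else b - 1) (\<sigma> i))"
  "closed_args \<sigma> \<Longrightarrow> rename_n (plug_n c \<sigma>) a k =
    plug_n c (\<lambda>i. apfst (\<lambda>b. if b < k then b else if b = k then a else b - 1) (\<sigma> i))"
proof (induction q and c arbitrary: \<sigma> a k and \<sigma> a k)
  case (Mu c)
  let ?r = "\<lambda>a k \<sigma> i. apfst (\<lambda>b. if b < k then b else if b = k then a else b - 1) (\<sigma> i)"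
  have "up (?r a k \<sigma>) = ?r (Suc a) (Suc k) (up \<sigma>)"
    by (auto simp: up_def fun_eq_iff apfst_def map_prod_def split: nat.split prod.split)
  with Mu show ?case by simp
next
  case (Named b t)
  then show ?case
    by (cases "snd (\<sigma> b)") (auto simp: closed_args_def rename_fresh)
qed auto


section \<open>The run of the machine\<close>

primrec W :: "nat \<Rightarrow> nat \<Rightarrow> trm" where
  "W f 0 = Var f"
| "W f (Suc k) = Lam (App (liftL (W f k) 0) (App s (Var 0)))"

lemma fmv_W [simp]: "fmv (W f k) = {}"
  by (induction k) auto

lemma W_unwinds: "App (W f k) t \<succ> App (Var f) (((\<lambda>v. App s v) ^^ k) t)"
proof (induction k arbitrary: t)
  case 0
  then show ?case by (simp add: head_red_def)
next
  case (Suc k)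
  have "head_step (App (W f (Suc k)) t) (App (W f k) (App s t))"
    using head_step_App_root[OF contract.C1, of "App (liftL (W f k) 0) (App s (Var 0))" t] by simp
  from head_red_step[OF this Suc.IH] show ?case by (simp add: funpow_swap1)
qed

text \<open>The environment of a state: every free \<open>\<mu>\<close>-variable has been merged into the outermost one.\<close>

definition env_of :: "nat \<Rightarrow> (nat \<Rightarrow> nat) \<Rightarrow> env" where
  "env_of f \<rho> = (\<lambda>i. (0, Some (W f (\<rho> i))))"

definition state :: "nat \<Rightarrow> (nat \<Rightarrow> nat) \<Rightarrow> trm \<Rightarrow> nat \<Rightarrow> trm" where
  "state f \<rho> q k = App (plug q (env_of f \<rho>)) (W f k)"

lemma closed_args_env_of [simp]: "closed_args (env_of f \<rho>)"
  by (simp add: closed_args_def env_of_def)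

lemma rename_env_of:
  "rename (plug q (env_of f \<rho>)) 0 0 = plug q (env_of f \<rho>)"
  by (simp add: rename_plug, simp add: env_of_def)

text \<open>
  Every free name of a state is \<open>\<alpha>\<close> and labels an application. Hence \<open>S3\<close> never applies to the
  binder, and \<open>S2\<close> applies exactly when nothing is left that can jump.
\<close>

lemma redex_Mu_state:
  assumes "q \<in> N 1 0"
  shows "redex (Mu (Named 0 (state f \<rho> q k))) \<longleftrightarrow> fmv q = {}"
  using assms Lam_notin_named_subs_plug(1)[of "env_of f \<rho>" 0 _ q]
  by (auto simp: redex_Mu state_def fmv_plug named_subs_fresh, auto simp: env_of_def)

lemma S2_state:
  assumes "q \<in> N 1 0" "fmv q = {}"
  shows "head_step (Mu (Named 0 (state f \<rho> q k))) (state f \<rho> q k)"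
proof -
  have "0 \<notin> fmv (state f \<rho> q k)"
    using assms by (simp add: state_def fmv_plug)
  from head_step_Mu_root[OF contract.S2[OF this]] show ?thesis
    by (simp add: state_def rename_env_of rename_fresh)
qed

lemma C1_x: "head_step (state f \<rho> (Var 1) k) (App (W f k) zero)"
  using head_step_App_root[OF contract.C1, of "App (Var 0) zero" "W f k"]
  by (simp add: state_def \<delta>_def zero_def)

text \<open>The intermediate term of the two \<open>\<beta>\<close>-steps at \<open>(f)u\<close>.\<close>

definition half_unfolded :: "nat \<Rightarrow> (nat \<Rightarrow> nat) \<Rightarrow> trm \<Rightarrow> trm" where
  "half_unfolded f \<rho> u = Lam (App (liftL (plug u (env_of f \<rho>)) 0) (Lam (App (Var 1) (App s (Var 0)))))"

lemma C1_f:
  "head_step (state f \<rho> (App (Var 0) u) k) (App (half_unfolded f \<rho> u) (W f k))"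
  "head_step (App (half_unfolded f \<rho> u) (W f k)) (state f \<rho> u (Suc k))"
proof -
  have "head_step (App G (plug u (env_of f \<rho>))) (half_unfolded f \<rho> u)"
    using head_step_App_root[OF contract.C1,
        of "Lam (App (Var 1) (Lam (App (Var 1) (App s (Var 0)))))" "plug u (env_of f \<rho>)"]
    by (simp add: G_def half_unfolded_def)
  from head_step_App[OF this] show "head_step (state f \<rho> (App (Var 0) u) k) (App (half_unfolded f \<rho> u) (W f k))"
    by (simp add: state_def)
  show "head_step (App (half_unfolded f \<rho> u) (W f k)) (state f \<rho> u (Suc k))"
    unfolding half_unfolded_def
    using head_step_App_root[OF contract.C1,
      of "App (liftL (plug u (env_of f \<rho>)) 0) (Lam (App (Var 1) (App s (Var 0))))" "W f k"]
    by (simp add: state_def)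
qed

lemma redex_Mu_half_unfolded:
  assumes "u \<in> N 1 0"
  shows "redex (Mu (Named 0 (App (half_unfolded f \<rho> u) (W f k)))) \<longleftrightarrow> fmv u = {}"
proof -
  \<comment> \<open>\<open>half_unfolded\<close> is itself an abstraction, but it is labelled only as part of an application.\<close>
  have "\<not> (\<exists>w. Lam w \<in> named_subs 0 (liftL (plug u (env_of f \<rho>)) 0))"
    unfolding Lam_named_subs_liftL
    using Lam_notin_named_subs_plug(1)[of "env_of f \<rho>" 0 _ u] closed_args_env_of
    by (auto simp: env_of_def)
  then show ?thesis
    using assms by (auto simp: redex_Mu half_unfolded_def fmv_plug named_subs_fresh, auto simp: env_of_def)
qed

text \<open>
  At \<open>\<mu>\<gamma>[\<beta>]q\<close> the level of \<open>\<gamma>\<close> becomes \<open>k\<close>. Between \<open>C2\<close> and \<open>S1\<close>, \<open>\<gamma>\<close> and \<open>\<alpha>\<close> are still two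
  names.
\<close>

definition env_before_S1 :: "nat \<Rightarrow> (nat \<Rightarrow> nat) \<Rightarrow> nat \<Rightarrow> env" where
  "env_before_S1 f \<rho> k = (up (env_of f \<rho>))(0 := (0, Some (W f k)))"

lemma closed_args_env_before_S1 [simp]: "closed_args (env_before_S1 f \<rho> k)"
proof -
  have "closed_args (up (env_of f \<rho>))" by simp
  then show ?thesis unfolding closed_args_def env_before_S1_def by simp
qed

lemma C2_Mu:
  "head_step (state f \<rho> (Mu c) k) (Mu (plug_n c (env_before_S1 f \<rho> k)))"
proof -
  have "(\<lambda>i. if fst (up (env_of f \<rho>) i) = 0 then (0, Some (W f k)) else up (env_of f \<rho>) i)
      = env_before_S1 f \<rho> k"
    by (auto simp: env_before_S1_def fun_eq_iff up_def split: nat.split)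
  moreover have "fst (up (env_of f \<rho>) i) = 0 \<Longrightarrow> snd (up (env_of f \<rho>) i) = None" for i
    by (cases i) auto
  ultimately have "ssubst_n (plug_n c (up (env_of f \<rho>))) (W f k) 0 = plug_n c (env_before_S1 f \<rho> k)"
    by (simp add: ssubst_plug)
  then show ?thesis
    using head_step_App_root[OF contract.C2, of "plug_n c (up (env_of f \<rho>))" "W f k"]
    by (simp add: state_def liftM_fresh)
qed

lemma plug_n_env_of:
  "Mu (plug_n (Named b q) (env_of f \<rho>)) = Mu (Named 0 (state f \<rho> q (\<rho> b)))"
  by (simp add: state_def) (simp add: env_of_def)

text \<open>
  As \<open>q\<close> is not itself a \<open>\<mu>\<close>-term, \<open>(q'')W\<close> has a \<open>\<beta>\<close>-redex in head position; this is what makes the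
  inner \<open>\<mu>\<close>-term, and with it the whole term, not head normal. If \<open>\<mu>\<gamma>[\<beta>]q\<close> had no free
  \<open>\<mu>\<close>-variable, \<open>S2\<close> would take precedence over \<open>S1\<close>.
\<close>

lemma S1_Mu:
  assumes q: "q = Var 1 \<or> (\<exists>u \<in> N 1 0. q = App (Var 0) u)"
    and occ: "fmv (Mu (Named b q)) \<noteq> {}"
  shows "head_step (Mu (Named 0 (Mu (plug_n (Named b q) (env_before_S1 f \<rho> k)))))
           (Mu (Named 0 (state f (case_nat k \<rho>) q (case_nat k \<rho> b))))"
proof -
  let ?c = "plug_n (Named b q) (env_before_S1 f \<rho> k)"
  have N: "q \<in> N 1 0" using q by (auto intro: N.intros)
  have args: "\<exists>w. snd (env_before_S1 f \<rho> k i) = Some w" for i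
    by (cases i) (auto simp: env_before_S1_def env_of_def)
  obtain i where "Suc i \<in> insert b (fmv q)" using occ by auto
  moreover have "fst (env_before_S1 f \<rho> k (Suc i)) = 1" by (simp add: env_before_S1_def env_of_def)
  ultimately have "1 \<in> fmv_n ?c"
    using N by (auto simp: fmv_plug fmv_apply_opt intro: rev_image_eqI)
  moreover have "Lam w \<notin> named_subs_n 1 ?c" for w
    using args by (intro Lam_notin_named_subs_plug(2)) auto
  ultimately have "\<not> redex (Mu (Named 0 (Mu ?c)))"
    by (simp add: redex_Mu)
  moreover have "Mu ?c \<notin> hnf"
  proof -
    obtain w where "snd (env_before_S1 f \<rho> k b) = Some w" using args by blast
    with q show ?thesis by (auto simp: hnf_App hnf_Mu \<delta>_def G_def)
  qed
  ultimately have "head_step (Mu (Named 0 (Mu ?c))) (Mu (rename_n ?c 0 0))"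
    by (rule head_step_S1)
  moreover have "(\<lambda>i. apfst (\<lambda>b. if b < 0 then b else if b = 0 then 0 else b - 1) (env_before_S1 f \<rho> k i))
      = env_of f (case_nat k \<rho>)"
    by (auto simp: env_before_S1_def env_of_def fun_eq_iff up_def split: nat.split)
  then have "Mu (rename_n ?c 0 0) = Mu (Named 0 (state f (case_nat k \<rho>) q (case_nat k \<rho> b)))"
    unfolding rename_plug(2)[OF closed_args_env_before_S1] by (simp only: plug_n_env_of)
  ultimately show ?thesis by simp
qed

text \<open>
  The invariant of the run: whichever value is eventually read off, at the current position or after
  a jump, it completes the level in force there to \<open>n\<close>.
\<close>

definition fits :: "nat \<Rightarrow> (nat \<Rightarrow> nat) \<Rightarrow> trm \<Rightarrow> nat \<Rightarrow> bool" where
  "fits n \<rho> q k \<longleftrightarrow> (\<forall>m \<in> val 1 0 q. k + m = n) \<and>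
    (\<forall>b. \<forall>v \<in> named_subs b q. \<forall>m \<in> val 1 0 v. \<rho> b + m = n)"

lemma fits_f: "fits n \<rho> (App (Var 0) u) k \<Longrightarrow> fits n \<rho> u (Suc k)"
  by (auto simp: fits_def)

text \<open>
  A value of \<open>\<mu>\<gamma>[\<beta>]q\<close> is a value of some \<open>[\<gamma>]v\<close> in \<open>[\<beta>]q\<close>, so storing \<open>k\<close> for \<open>\<gamma>\<close> is right. The jump
  is right because \<open>[\<beta>]q\<close> counts among its own named subterms.
\<close>

lemma fits_Mu:
  assumes "fits n \<rho> (Mu (Named b q)) k"
  shows "fits n (case_nat k \<rho>) q (case_nat k \<rho> b)"
proof -
  have "case_nat k \<rho> a + m = n" if "v \<in> named_subs_n a (Named b q)" "m \<in> val 1 0 v" for a v m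
    using assms that by (cases a) (auto simp: fits_def simp del: named_subs_n.simps)
  then show ?thesis by (fastforce simp: fits_def)
qed

text \<open>
  The form without a binder is only a state of the machine if no free \<open>\<mu>\<close>-variable is left, since
  \<open>env_of\<close> renames these to the binder \<open>\<alpha>\<close>.
\<close>

definition runs :: "nat \<Rightarrow> nat \<Rightarrow> trm \<Rightarrow> bool" where
  "runs f n q \<longleftrightarrow> (\<forall>\<rho> k. fits n \<rho> q k \<longrightarrow>
    (let r = App (Var f) (((\<lambda>v. App s v) ^^ n) zero) in
      (fmv q = {} \<longrightarrow> state f \<rho> q k \<succ> r) \<and> Mu (Named 0 (state f \<rho> q k)) \<succ> r))"

lemma runsI:
  assumes "q \<in> N 1 0"
    and "\<And>\<rho> k. fits n \<rho> q k \<Longrightarrow> fmv q = {} \<Longrightarrow>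
      state f \<rho> q k \<succ> App (Var f) (((\<lambda>v. App s v) ^^ n) zero)"
    and "\<And>\<rho> k. fits n \<rho> q k \<Longrightarrow> fmv q \<noteq> {} \<Longrightarrow>
      Mu (Named 0 (state f \<rho> q k)) \<succ> App (Var f) (((\<lambda>v. App s v) ^^ n) zero)"
  shows "runs f n q"
  unfolding runs_def Let_def
proof (intro allI impI conjI)
  fix \<rho> k assume *: "fits n \<rho> q k"
  show "Mu (Named 0 (state f \<rho> q k)) \<succ> App (Var f) (((\<lambda>v. App s v) ^^ n) zero)"
  proof (cases "fmv q = {}")
    case True
    from head_red_step[OF S2_state[OF assms(1) True] assms(2)[OF * True]] show ?thesis .
  next
    case False
    with assms(3) * show ?thesis .
  qed
qed (rule assms(2))

lemma runs_x: "runs f n (Var 1)"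
proof (rule runsI)
  fix \<rho> k assume "fits n \<rho> (Var 1) k"
  then have "k = n" by (simp add: fits_def)
  then show "state f \<rho> (Var 1) k \<succ> App (Var f) (((\<lambda>v. App s v) ^^ n) zero)"
    using head_red_step[OF C1_x W_unwinds] by blast
qed (auto intro: N.intros)

lemma runs_f:
  assumes "u \<in> N 1 0" "runs f n u"
  shows "runs f n (App (Var 0) u)"
proof (rule runsI)
  fix \<rho> k
  assume *: "fits n \<rho> (App (Var 0) u) k"
  {
    assume "fmv (App (Var 0) u) = {}"
    with * assms(2) have "state f \<rho> u (Suc k) \<succ> App (Var f) (((\<lambda>v. App s v) ^^ n) zero)"
      by (simp add: runs_def Let_def fits_f)
    then show "state f \<rho> (App (Var 0) u) k \<succ> App (Var f) (((\<lambda>v. App s v) ^^ n) zero)"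
      using head_red_step C1_f by blast
  next
    assume occ: "fmv (App (Var 0) u) \<noteq> {}"
    have 1: "head_step (Mu (Named 0 (state f \<rho> (App (Var 0) u) k)))
        (Mu (Named 0 (App (half_unfolded f \<rho> u) (W f k))))"
      using C1_f(1) redex_Mu_state[OF N_f[OF assms(1)]] occ
      by (intro head_step_Mu) (auto simp: state_def)
    have 2: "head_step (Mu (Named 0 (App (half_unfolded f \<rho> u) (W f k))))
        (Mu (Named 0 (state f \<rho> u (Suc k))))"
      using C1_f(2) redex_Mu_half_unfolded[OF assms(1)] occ
      by (intro head_step_Mu) auto
    have "Mu (Named 0 (state f \<rho> u (Suc k))) \<succ> App (Var f) (((\<lambda>v. App s v) ^^ n) zero)"
      using * assms(2) by (simp add: runs_def Let_def fits_f)
    with 1 2 show "Mu (Named 0 (state f \<rho> (App (Var 0) u) k)) \<succ>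
        App (Var f) (((\<lambda>v. App s v) ^^ n) zero)"
      using head_red_step by blast
  }
qed (use assms in \<open>auto intro: N.intros\<close>)

lemma runs_Mu:
  assumes q: "q = Var 1 \<or> (\<exists>u \<in> N 1 0. q = App (Var 0) u)" and "runs f n q"
  shows "runs f n (Mu (Named b q))"
proof (rule runsI)
  show N: "Mu (Named b q) \<in> N 1 0" using q by (auto intro: N.intros)
  fix \<rho> k
  assume *: "fits n \<rho> (Mu (Named b q)) k"
  let ?r = "App (Var f) (((\<lambda>v. App s v) ^^ n) zero)"
  have cont: "Mu (Named 0 (state f (case_nat k \<rho>) q (case_nat k \<rho> b))) \<succ> ?r"
    using assms(2) fits_Mu[OF *] by (simp add: runs_def Let_def)
  {
    assume "fmv (Mu (Named b q)) = {}"
    \<comment> \<open>Then \<open>\<gamma>\<close> is the only name in \<open>[\<beta>]q\<close>, so it takes over the role of \<open>\<alpha>\<close> without \<open>S1\<close>.\<close>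
    then have closed: "i = 0" if "i \<in> insert b (fmv q)" for i
      using that by (cases i) auto
    have "plug_n (Named b q) (env_before_S1 f \<rho> k) = plug_n (Named b q) (env_of f (case_nat k \<rho>))"
    proof (rule plug_cong)
      fix i assume "i \<in> fmv_n (Named b q)"
      then have "i = 0" using closed by simp
      then show "env_before_S1 f \<rho> k i = env_of f (case_nat k \<rho>) i"
        by (simp add: env_before_S1_def env_of_def)
    qed
    then have "Mu (plug_n (Named b q) (env_before_S1 f \<rho> k)) =
        Mu (Named 0 (state f (case_nat k \<rho>) q (case_nat k \<rho> b)))"
      by (simp only: plug_n_env_of)
    then show "state f \<rho> (Mu (Named b q)) k \<succ> ?r"
      using head_red_step[OF C2_Mu] cont by metis
  next
    assume occ: "fmv (Mu (Named b q)) \<noteq> {}"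
    have "head_step (Mu (Named 0 (state f \<rho> (Mu (Named b q)) k)))
        (Mu (Named 0 (Mu (plug_n (Named b q) (env_before_S1 f \<rho> k)))))"
      using C2_Mu redex_Mu_state[OF N] occ
      by (intro head_step_Mu) (simp_all only: redex_n, simp_all add: state_def)
    then show "Mu (Named 0 (state f \<rho> (Mu (Named b q)) k)) \<succ> ?r"
      using head_red_step S1_Mu[OF q occ] cont by blast
  }
qed

lemma runs_N: "u \<in> N 1 0 \<Longrightarrow> runs f n u"
proof (induction rule: N.induct)
  case (N_f u)
  then show ?case by (rule runs_f)
next
  case (N_Mu_f u b)
  then show ?case by (blast intro: runs_f runs_Mu)
qed (blast intro: runs_x runs_Mu)+

theorem mainTheorem3:
  fixes u \<theta> :: trm and n f :: nat
  assumes "u \<in> N 1 0"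
    and "fmv u = {}"
    and "val 1 0 u = {n}"
    and "\<theta> = Lam (Lam u)"
  shows "App (App T1 \<theta>) (Var f) \<succ> App (Var f) (((\<lambda>v. App s v) ^^ n) zero)"
proof -
  let ?W = "Var f"
  have "head_step (App T1 \<theta>) (App (App \<theta> \<delta>) G)"
    using head_step_App_root[OF contract.C1, of "App (App (Var 0) \<delta>) G" \<theta>]
    by (simp add: T1_def subst_liftL(1)[of G 0, simplified])
  from head_step_App[OF this, of ?W]
  have 1: "head_step (App (App T1 \<theta>) ?W) (App (App (App \<theta> \<delta>) G) ?W)"
    by (simp add: T1_def)
  have "head_step (App \<theta> \<delta>) (Lam (subst u \<delta> 1))"
    using head_step_App_root[OF contract.C1, of "Lam u" \<delta>] by (simp add: assms(4))
  from head_step_App[OF head_step_App[OF this, of G], of ?W]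
  have 2: "head_step (App (App (App \<theta> \<delta>) G) ?W) (App (App (Lam (subst u \<delta> 1)) G) ?W)"
    by (simp add: assms(4))
  have "head_step (App (Lam (subst u \<delta> 1)) G) (plug u (\<lambda>i. (i, None)))"
    using head_step_App_root[OF contract.C1, of "subst u \<delta> 1" G] subst_eq_plug[OF assms(1)]
    by simp
  moreover have "plug u (\<lambda>i. (i, None)) = plug u (env_of f (\<lambda>_. 0))"
    by (rule plug_cong) (simp add: assms(2))
  ultimately have "head_step (App (Lam (subst u \<delta> 1)) G) (plug u (env_of f (\<lambda>_. 0)))"
    by simp
  from head_step_App[OF this, of ?W]
  have 3: "head_step (App (App (Lam (subst u \<delta> 1)) G) ?W) (state f (\<lambda>_. 0) u 0)"
    by (simp add: state_def)
  have "fits n (\<lambda>_. 0) u 0"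
    using assms(2,3) by (simp add: fits_def named_subs_fresh)
  then have "state f (\<lambda>_. 0) u 0 \<succ> App (Var f) (((\<lambda>v. App s v) ^^ n) zero)"
    using runs_N[OF assms(1)] assms(2) by (simp add: runs_def Let_def)
  then show ?thesis
    by (intro head_red_step[OF 1] head_red_step[OF 2] head_red_step[OF 3])
qed

end
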